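(* The class of circuit-difference matroids is closed under series minors; that is, every series minor of a circuit-difference matroid is a circuit-difference matroid.
   Context: All matroids are finite. A matroid $M$ is circuit-difference if the symmetric difference $C_1\triangle C_2$ is a circuit of $M$ whenever $C_1$ and $C_2$ are distinct circuits of $M$ with $C_1\cap C_2\neq\emptyset$. A series contraction of a matroid is the contraction of an element $e$ for which there is an element $f\neq e$ such that $\{e,f\}$ is a cocircuit. A series minor of $M$ is a matroid obtained from $M$ by a (possibly empty) sequence of single-element deletions and series contractions. *)

theory Defs
  imports Main
begin

record 'a set_system =
  ground :: "'a set"
  indeps :: "'a set set"

locale matroid =
  fixes M :: "'a set_system"
  assumes finite_ground: "finite (ground M)"
    and indeps_subset: "I \<in> indeps M \<Longrightarrow> I \<subseteq> ground M"
    and empty_indep: "{} \<in> indeps M"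
    and indep_subset: "\<lbrakk>I \<in> indeps M; J \<subseteq> I\<rbrakk> \<Longrightarrow> J \<in> indeps M"
    and augment: "\<lbrakk>I \<in> indeps M; J \<in> indeps M; card I < card J\<rbrakk> \<Longrightarrow>
      \<exists>x \<in> J - I. insert x I \<in> indeps M"

definition circuit :: "'a set_system \<Rightarrow> 'a set \<Rightarrow> bool" where
  "circuit M C \<longleftrightarrow> C \<subseteq> ground M \<and> C \<notin> indeps M \<and> (\<forall>D. D \<subset> C \<longrightarrow> D \<in> indeps M)"

definition basis_of :: "'a set_system \<Rightarrow> 'a set \<Rightarrow> 'a set \<Rightarrow> bool" where
  "basis_of M X B \<longleftrightarrow> B \<subseteq> X \<and> B \<in> indeps M \<and>
    (\<forall>D \<in> indeps M. B \<subseteq> D \<and> D \<subseteq> X \<longrightarrow> D = B)"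

abbreviation basis :: "'a set_system \<Rightarrow> 'a set \<Rightarrow> bool" where
  "basis M \<equiv> basis_of M (ground M)"

(* The bases of the dual are the complements of the bases of M. *)
definition dual_matroid :: "'a set_system \<Rightarrow> 'a set_system" where
  "dual_matroid M =
    \<lparr>ground = ground M, indeps = {I. \<exists>B. basis M B \<and> I \<subseteq> ground M - B}\<rparr>"

definition cocircuit :: "'a set_system \<Rightarrow> 'a set \<Rightarrow> bool" where
  "cocircuit M C \<longleftrightarrow> circuit (dual_matroid M) C"

definition delete :: "'a set_system \<Rightarrow> 'a set \<Rightarrow> 'a set_system" where
  "delete M X = \<lparr>ground = ground M - X, indeps = {I \<in> indeps M. I \<subseteq> ground M - X}\<rparr>"

(* In a matroid the choice of the basis B of X does not matter. If X = {e} with e a loop,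
   then B = {} and contracting e is the same as deleting it. *)
definition contract :: "'a set_system \<Rightarrow> 'a set \<Rightarrow> 'a set_system" where
  "contract M X =
    \<lparr>ground = ground M - X,
     indeps = {I. I \<subseteq> ground M - X \<and> (\<exists>B. basis_of M X B \<and> I \<union> B \<in> indeps M)}\<rparr>"

(* series_minor M N: N is a series minor of M. The series pair {e, f} is a cocircuit of the
   current matroid N, not of the initial matroid M. *)
inductive series_minor :: "'a set_system \<Rightarrow> 'a set_system \<Rightarrow> bool" for M where
  refl: "series_minor M M"
| deletion: "\<lbrakk>series_minor M N; e \<in> ground N\<rbrakk> \<Longrightarrow> series_minor M (delete N {e})"
| series_contraction: "\<lbrakk>series_minor M N; e \<noteq> f; cocircuit N {e, f}\<rbrakk> \<Longrightarrow>
    series_minor M (contract N {e})"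

definition circuit_difference_matroid :: "'a set_system \<Rightarrow> bool" where
  "circuit_difference_matroid M \<longleftrightarrow> matroid M \<and>
    (\<forall>C1 C2. circuit M C1 \<and> circuit M C2 \<and> C1 \<noteq> C2 \<and> C1 \<inter> C2 \<noteq> {} \<longrightarrow>
      circuit M ((C1 - C2) \<union> (C2 - C1)))"

end

theory Submission
  imports Defs
begin

text \<open>
  If \<open>{e, f}\<close> is a cocircuit of \<open>N\<close>, then every circuit through \<open>e\<close> also passes through \<open>f\<close>.
  Consequently the circuits of \<open>N / e\<close> are exactly the sets \<open>C - {e}\<close> with \<open>C\<close> a circuit of \<open>N\<close>
  (in general only the minimal ones among these are circuits). Since removing \<open>e\<close> commutes with
  symmetric difference, the circuit-difference property passes from \<open>N\<close> to \<open>N / e\<close>.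
\<close>

section \<open>Circuits, independent sets and bases\<close>

lemma dependent_contains_circuit:
  assumes "matroid M" "X \<subseteq> ground M" "X \<notin> indeps M"
  obtains C where "circuit M C" "C \<subseteq> X"
proof -
  have "finite X"
    using assms finite_subset matroid.finite_ground by blast
  then have "\<exists>C. circuit M C \<and> C \<subseteq> X"
    using assms(2,3)
  proof (induction X rule: finite_psubset_induct)
    case (psubset X)
    show ?case
    proof (cases "\<forall>D. D \<subset> X \<longrightarrow> D \<in> indeps M")
      case True
      with psubset.prems show ?thesis
        by (auto simp: circuit_def)
    next
      case False
      then obtain D where D: "D \<subset> X" "D \<notin> indeps M"
        by blast
      moreover have "D \<subseteq> ground M"
        using D psubset.prems by blast
      ultimately show ?thesis
        using psubset.IH[of D] by blast
    qed
  qed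
  with that show ?thesis
    by blast
qed

text \<open>A maximal independent set between \<open>I\<close> and \<open>I \<union> B\<close>
  cannot be smaller than \<open>B\<close>, since augmentation from \<open>B\<close> would enlarge
  it. When \<open>B\<close> is a basis, this extends \<open>I\<close> to a basis while controlling
  which new elements may enter.\<close>

lemma indep_extends_within:
  assumes "matroid M" "I \<in> indeps M" "B \<in> indeps M"
  obtains J where "J \<in> indeps M" "I \<subseteq> J" "J \<subseteq> I \<union> B" "card B \<le> card J"
proof -
  interpret matroid M by fact
  define S where "S = {J \<in> indeps M. I \<subseteq> J \<and> J \<subseteq> I \<union> B}"
  have "finite S"
    by (rule finite_subset[of _ "Pow (ground M)"])
      (use indeps_subset finite_ground in \<open>auto simp: S_def\<close>)
  moreover have "S \<noteq> {}"
    using assms(2) by (auto simp: S_def)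
  ultimately obtain J where J: "J \<in> S" and maxi: "\<And>K. K \<in> S \<Longrightarrow> J \<subseteq> K \<Longrightarrow> J = K"
    using finite_has_maximal[of S] by auto
  have "card B \<le> card J"
  proof (rule ccontr)
    assume "\<not> card B \<le> card J"
    then obtain x where x: "x \<in> B - J" "insert x J \<in> indeps M"
      using augment[of J B] J assms(3) by (auto simp: S_def)
    then have "insert x J \<in> S"
      using J by (auto simp: S_def)
    with maxi x(1) show False
      by blast
  qed
  with J that show ?thesis
    by (auto simp: S_def)
qed

lemma card_basis_maximal:
  assumes "matroid M" "basis M B" "I \<in> indeps M"
  shows "card I \<le> card B"
proof (rule ccontr)
  interpret matroid M by fact
  assume "\<not> card I \<le> card B"
  then obtain x where x: "x \<in> I - B" "insert x B \<in> indeps M"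
    using augment[of B I] assms by (auto simp: basis_of_def)
  then have "insert x B = B"
    using assms(2) indeps_subset[OF x(2)] by (auto simp: basis_of_def)
  with x(1) show False
    by blast
qed

text \<open>Bases can be recognised by size alone: no independent set is larger than
  \<open>B\<close>, so \<open>J\<close> already has the maximum cardinality and has no proper
  independent extension.\<close>

lemma basis_if_card_ge:
  assumes "matroid M" "basis M B" "J \<in> indeps M" "card B \<le> card J"
  shows "basis M J"
proof -
  interpret matroid M by fact
  have "D = J" if "D \<in> indeps M" "J \<subseteq> D" for D
  proof -
    have "finite D"
      using that indeps_subset finite_ground finite_subset by blast
    moreover have "card D \<le> card J"
      using card_basis_maximal[OF assms(1,2) that(1)] assms(4) by simp
    ultimately show ?thesis
      using card_seteq[of D J] that(2) by simp
  qed
  with assms(3) indeps_subset[OF assms(3)] show ?thesis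
    by (auto simp: basis_of_def)
qed

section \<open>Series pairs\<close>

lemma cocircuit_pairD:
  assumes "e \<noteq> f" "cocircuit M {e, f}"
  shows "e \<in> ground M"
    and "\<exists>B. basis M B \<and> f \<notin> B"
    and "\<And>B. basis M B \<Longrightarrow> e \<in> B \<or> f \<in> B"
proof -
  have sub: "{e, f} \<subseteq> ground M"
    and dep: "{e, f} \<notin> indeps (dual_matroid M)"
    and min: "\<And>D. D \<subset> {e, f} \<Longrightarrow> D \<in> indeps (dual_matroid M)"
    using assms(2) by (auto simp: cocircuit_def circuit_def dual_matroid_def)
  from sub show "e \<in> ground M"
    by simp
  \<comment> \<open>Independence in the dual means missing some basis of \<open>M\<close>.
    Minimality of the cocircuit gives this for \<open>{f}\<close>, while dependence of
    \<open>{e, f}\<close> says that every basis meets the pair.\<close>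
  have "{f} \<subset> {e, f}"
    using assms(1) by auto
  from min[OF this] show "\<exists>B. basis M B \<and> f \<notin> B"
    by (auto simp: dual_matroid_def)
  show "e \<in> B \<or> f \<in> B" if "basis M B" for B
    using dep sub that by (auto simp: dual_matroid_def)
qed

text \<open>A circuit and a cocircuit never meet in exactly one element. If \<open>f\<close> were
  outside \<open>C\<close>, then \<open>C - {e}\<close> would extend, by elements of a basis
  avoiding \<open>f\<close>, to a basis \<open>J\<close>. This \<open>J\<close> misses
  \<open>f\<close>, and it misses \<open>e\<close> because it cannot contain \<open>C\<close>; but
  every basis meets \<open>{e, f}\<close>.\<close>

lemma circuit_series_pair:
  assumes "matroid M" "e \<noteq> f" "cocircuit M {e, f}" "circuit M C" "e \<in> C"
  shows "f \<in> C"
proof (rule ccontr)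
  interpret matroid M by fact
  assume "f \<notin> C"
  obtain B where B: "basis M B" "f \<notin> B"
    using cocircuit_pairD(2)[OF assms(2,3)] by blast
  have "C - {e} \<in> indeps M"
    using assms(4,5) by (auto simp: circuit_def)
  moreover have "B \<in> indeps M"
    using B by (simp add: basis_of_def)
  ultimately obtain J where J: "J \<in> indeps M" "C - {e} \<subseteq> J" "J \<subseteq> (C - {e}) \<union> B"
    "card B \<le> card J"
    using indep_extends_within[OF assms(1)] by blast
  have "e \<notin> J"
  proof
    assume "e \<in> J"
    with J(2) have "C \<subseteq> J"
      by blast
    then show False
      using indep_subset[OF J(1)] assms(4) by (simp add: circuit_def)
  qed
  moreover have "f \<notin> J"
    using J(3) B(2) \<open>f \<notin> C\<close> by blast
  ultimately show False
    using cocircuit_pairD(3)[OF assms(2,3)] basis_if_card_ge[OF assms(1) B(1) J(1,4)] by blast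
qed

text \<open>A basis that avoids \<open>f\<close> must contain \<open>e\<close>, so \<open>e\<close>
  is not a loop and the simple description of contraction by a nonloop applies.\<close>

lemma series_pair_indep:
  assumes "matroid M" "e \<noteq> f" "cocircuit M {e, f}"
  shows "{e} \<in> indeps M"
proof -
  obtain B where "basis M B" "f \<notin> B"
    using cocircuit_pairD(2)[OF assms(2,3)] by blast
  moreover from this have "e \<in> B"
    using cocircuit_pairD(3)[OF assms(2,3)] by blast
  ultimately show ?thesis
    using matroid.indep_subset[OF assms(1), of B "{e}"] by (auto simp: basis_of_def)
qed

section \<open>Contraction of a nonloop and of a series element\<close>

lemma ground_contract [simp]: "ground (contract M X) = ground M - X"
  by (simp add: contract_def)

lemma indeps_contract_nonloop:
  assumes "{e} \<in> indeps M"
  shows "indeps (contract M {e}) = {I. I \<subseteq> ground M - {e} \<and> insert e I \<in> indeps M}"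
proof -
  have "basis_of M {e} B \<longleftrightarrow> B = {e}" for B
    using assms by (auto simp: basis_of_def)
  then show ?thesis
    by (simp add: contract_def)
qed

lemma matroid_contract_nonloop:
  assumes "matroid M" "{e} \<in> indeps M"
  shows "matroid (contract M {e})"
proof -
  interpret matroid M by fact
  note ind = indeps_contract_nonloop[OF assms(2)]
  show ?thesis
  proof
    show "finite (ground (contract M {e}))"
      using finite_ground by simp
    show "I \<subseteq> ground (contract M {e})" if "I \<in> indeps (contract M {e})" for I
      using that by (auto simp: ind)
    show "{} \<in> indeps (contract M {e})"
      using assms(2) by (simp add: ind)
    show "J \<in> indeps (contract M {e})" if "I \<in> indeps (contract M {e})" "J \<subseteq> I" for I J
      using that indep_subset[of "insert e I" "insert e J"] by (auto simp: ind)
    show "\<exists>x \<in> J - I. insert x I \<in> indeps (contract M {e})"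
      if I: "I \<in> indeps (contract M {e})" and J: "J \<in> indeps (contract M {e})"
        and "card I < card J" for I J
    proof -
      \<comment> \<open>Adding \<open>e\<close> raises both cardinalities by exactly one, so
        augmentation in \<open>M\<close> applies; the element it yields differs from
        \<open>e\<close>, which is already in the smaller set.\<close>
      have fin: "finite I" "finite J" and "e \<notin> I" "e \<notin> J"
        using I J finite_ground by (auto simp: ind intro: finite_subset)
      then have "card (insert e I) < card (insert e J)"
        using that(3) by simp
      then obtain x where "x \<in> insert e J - insert e I" "insert x (insert e I) \<in> indeps M"
        using augment[of "insert e I" "insert e J"] I J by (auto simp: ind)
      with I J show ?thesis
        by (auto simp: ind insert_commute)
    qed
  qed
qed

lemma circuit_series_contract_iff:
  assumes "matroid M" "e \<noteq> f" "cocircuit M {e, f}"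
  shows "circuit (contract M {e}) D \<longleftrightarrow> (\<exists>C. circuit M C \<and> D = C - {e})"
proof
  interpret matroid M by fact
  note ind = indeps_contract_nonloop[OF series_pair_indep[OF assms]]
  have e: "e \<in> ground M"
    using cocircuit_pairD(1)[OF assms(2,3)] .
  have dep: "C - {e} \<notin> indeps (contract M {e})" if "circuit M C" for C
    using that indep_subset[of "insert e C" C] by (auto simp: ind circuit_def)
  {
    assume D: "circuit (contract M {e}) D"
    then have "insert e D \<subseteq> ground M" "insert e D \<notin> indeps M"
      using e by (auto simp: circuit_def ind)
    then obtain C where C: "circuit M C" "C \<subseteq> insert e D"
      using dependent_contains_circuit[OF assms(1)] by blast
    \<comment> \<open>All proper subsets of \<open>D\<close> are independent in the contraction, and
      \<open>C - {e}\<close> is not; as it lies inside \<open>D\<close>, the two sets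
      coincide.\<close>
    have "\<not> C - {e} \<subset> D"
      using D dep[OF C(1)] by (auto simp: circuit_def)
    with C show "\<exists>C. circuit M C \<and> D = C - {e}"
      by blast
  }
  assume "\<exists>C. circuit M C \<and> D = C - {e}"
  then obtain C where C: "circuit M C" "D = C - {e}"
    by blast
  have "K \<in> indeps (contract M {e})" if "K \<subset> D" for K
  proof -
    have K: "K \<subseteq> ground M - {e}" "K \<subset> C"
      using that C by (auto simp: circuit_def)
    have "insert e K \<in> indeps M"
    proof (rule ccontr)
      assume "insert e K \<notin> indeps M"
      then obtain C' where C': "circuit M C'" "C' \<subseteq> insert e K"
        using dependent_contains_circuit[OF assms(1), of "insert e K"] K e by blast
      have "K \<in> indeps M"
        using C(1) K(2) by (auto simp: circuit_def)
      \<comment> \<open>The series pair is now used in both directions: \<open>C'\<close> passes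
        through \<open>e\<close>, hence through \<open>f\<close>, which then lies in
        \<open>K\<close> and so in \<open>C\<close>; swapping the roles of \<open>e\<close> and
        \<open>f\<close> puts \<open>e\<close> into \<open>C\<close>. Thus \<open>insert e K\<close>
        is a proper subset of the circuit \<open>C\<close>, yet dependent.\<close>
      then have "e \<in> C'"
        using C' indep_subset[of K C'] by (auto simp: circuit_def)
      then have "f \<in> C'"
        using circuit_series_pair[OF assms C'(1)] by blast
      then have "f \<in> C"
        using C'(2) K(2) assms(2) by blast
      moreover have "cocircuit M {f, e}"
        using assms(3) by (simp add: insert_commute)
      ultimately have "e \<in> C"
        using circuit_series_pair[OF assms(1) assms(2)[symmetric] _ C(1)] by blast
      then have "insert e K \<subset> C"
        using that C(2) by blast
      with C(1) \<open>insert e K \<notin> indeps M\<close> show False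
        by (auto simp: circuit_def)
    qed
    with K(1) show ?thesis
      by (simp add: ind)
  qed
  moreover have "D \<subseteq> ground (contract M {e})"
    using C by (auto simp: circuit_def)
  ultimately show "circuit (contract M {e}) D"
    using dep[OF C(1)] C(2) by (simp add: circuit_def)
qed

lemma circuit_difference_series_contract:
  assumes M: "circuit_difference_matroid M" and ef: "e \<noteq> f" "cocircuit M {e, f}"
  shows "circuit_difference_matroid (contract M {e})"
proof -
  have mat: "matroid M"
    using M by (simp add: circuit_difference_matroid_def)
  note iff = circuit_series_contract_iff[OF mat ef]
  have "circuit (contract M {e}) ((D1 - D2) \<union> (D2 - D1))"
    if D: "circuit (contract M {e}) D1" "circuit (contract M {e}) D2" "D1 \<noteq> D2" "D1 \<inter> D2 \<noteq> {}"
    for D1 D2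
  proof -
    obtain C1 C2 where C: "circuit M C1" "D1 = C1 - {e}" "circuit M C2" "D2 = C2 - {e}"
      using D(1,2) by (auto simp: iff)
    then have "C1 \<noteq> C2" "C1 \<inter> C2 \<noteq> {}"
      using D(3,4) by auto
    with M C(1,3) have "circuit M ((C1 - C2) \<union> (C2 - C1))"
      by (simp add: circuit_difference_matroid_def)
    moreover have "(D1 - D2) \<union> (D2 - D1) = ((C1 - C2) \<union> (C2 - C1)) - {e}"
      using C by blast
    ultimately show ?thesis
      by (auto simp: iff)
  qed
  with matroid_contract_nonloop[OF mat series_pair_indep[OF mat ef]] show ?thesis
    by (simp add: circuit_difference_matroid_def)
qed

section \<open>Deletion and the closure theorem\<close>

lemma matroid_delete:
  assumes "matroid M"
  shows "matroid (delete M X)"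
proof -
  interpret matroid M by fact
  show ?thesis
  proof
    show "\<exists>x \<in> J - I. insert x I \<in> indeps (delete M X)"
      if "I \<in> indeps (delete M X)" "J \<in> indeps (delete M X)" "card I < card J" for I J
      using that augment[of I J] by (fastforce simp: delete_def)
    show "J \<in> indeps (delete M X)" if "I \<in> indeps (delete M X)" "J \<subseteq> I" for I J
      using that indep_subset[of I J] by (auto simp: delete_def)
  qed (use finite_ground empty_indep in \<open>auto simp: delete_def\<close>)
qed

lemma circuit_delete_iff: "circuit (delete M X) C \<longleftrightarrow> circuit M C \<and> C \<inter> X = {}"
  by (auto simp: circuit_def delete_def)

text \<open>The circuits that survive are those disjoint from \<open>X\<close>, and the symmetric
  difference of two sets disjoint from \<open>X\<close> is again disjoint from
  \<open>X\<close>.\<close>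

lemma circuit_difference_delete:
  assumes "circuit_difference_matroid M"
  shows "circuit_difference_matroid (delete M X)"
  using assms matroid_delete[of M X]
  by (auto simp: circuit_difference_matroid_def circuit_delete_iff)

theorem lemma4p1:
  fixes M N :: "'a set_system"
  assumes "circuit_difference_matroid M"
    and "series_minor M N"
  shows "circuit_difference_matroid N"
  \<comment> \<open>Rule induction consumes the first fact, the derivation of the series minor. Each
    step applies a closure lemma to the current matroid, whose own cocircuit supplies the series
    pair.\<close>
  using assms(2,1)
  by induction (auto intro: circuit_difference_delete circuit_difference_series_contract)

end
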